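(* The metric $M_{AIC}(\mathcal{G},\vec C)=\log M_{ML}(\mathcal{G},\vec C)-\mathrm{Dim}(\mathcal{G})$ is score equivalent; that is, for all dags $\mathcal{G},\mathcal{G}'$ over the same set of variables and every database $\vec C$, $\mathcal{G}\approx\mathcal{G}'$ implies $M_{AIC}(\mathcal{G},\vec C)=M_{AIC}(\mathcal{G}',\vec C)$.
   Context: All graphs have the same finite vertex set $U=\{x_1,\dots,x_n\}$; a dag is an acyclic directed graph on $U$. Each node $x_i$ is a discrete variable with a finite number $r_i\ge 2$ of states. $\Pi_i^{\mathcal{G}}$ denotes the set of parents of $x_i$ in $\mathcal{G}$. A Bayesian network with structure $\mathcal{G}$ is a pair $(\mathcal{G},\theta_{\mathcal{G}})$ where $\theta_{\mathcal{G}}$ is a collection of conditional distributions $p(x_i\mid\Pi_i^{\mathcal{G}})$; it defines the joint distribution $\prod_i p(x_i\mid\Pi_i^{\mathcal{G}})$. Two dags are equivalent, written $\mathcal{G}\approx\mathcal{G}'$, if for every Bayesian network $(\mathcal{G},\theta_{\mathcal{G}})$ there is a Bayesian network $(\mathcal{G}',\theta_{\mathcal{G}'})$ defining the same joint distribution, and vice versa. Known fact (Verma and Pearl): $\mathcal{G}\approx\mathcal{G}'$ if and only if they have the same skeleton (underlying undirected graph) and the same v-structures (ordered triples $(x,y,z)$ of distinct nodes with $x\to y$, $z\to y$ and $x,z$ not adjacent). A database $\vec C=\{C_1,\dots,C_N\}$, $N\ge1$, consists of $N$ cases, each a full assignment of states to all variables in $U$. The likelihood $L(\mathcal{G},\theta_{\mathcal{G}},\vec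 C)$ is the probability of the data under $(\mathcal{G},\theta_{\mathcal{G}})$, i.e. the product over $l=1,\dots,N$ of the probability of $C_l$ under the joint distribution defined by $(\mathcal{G},\theta_{\mathcal{G}})$. The maximum likelihood metric is $M_{ML}(\mathcal{G},\vec C)=\max_{\theta_{\mathcal{G}}}L(\mathcal{G},\theta_{\mathcal{G}},\vec C)$. The number of parameters is $\mathrm{Dim}(\mathcal{G})=\sum_{i=1}^n(r_i-1)\prod_{x_j\in\Pi_i^{\mathcal{G}}}r_j$. *)

theory Defs
  imports "HOL-Analysis.Analysis"
begin

text \<open>
  Variables are the elements of a finite set \<open>U\<close>; the states of the variable \<open>i\<close> are
  \<open>0, \<dots>, r i - 1\<close>. A graph on \<open>U\<close> is its set of arcs \<open>(j, i)\<close>, read \<open>j \<rightarrow> i\<close>.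
\<close>

definition dag :: "'v set \<Rightarrow> 'v rel \<Rightarrow> bool" where
  "dag U G \<longleftrightarrow> G \<subseteq> U \<times> U \<and> acyclic G"

definition parents :: "'v rel \<Rightarrow> 'v \<Rightarrow> 'v set" where
  "parents G i = {j. (j, i) \<in> G}"

definition assignments :: "('v \<Rightarrow> nat) \<Rightarrow> 'v set \<Rightarrow> ('v \<Rightarrow> nat) set" where
  "assignments r A = (\<Pi>\<^sub>E i\<in>A. {..<r i})"

text \<open>
  \<open>\<theta> i \<pi> s\<close> is the conditional probability that variable \<open>i\<close> is in state \<open>s\<close> given that its
  parents are in the configuration \<open>\<pi>\<close>. Values of \<open>\<theta>\<close> at other arguments are irrelevant.
\<close>

type_synonym 'v params = "'v \<Rightarrow> ('v \<Rightarrow> nat) \<Rightarrow> nat \<Rightarrow> real"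

definition bn_params :: "'v set \<Rightarrow> ('v \<Rightarrow> nat) \<Rightarrow> 'v rel \<Rightarrow> 'v params set" where
  "bn_params U r G = {\<theta>. \<forall>i\<in>U. \<forall>\<pi>\<in>assignments r (parents G i).
     (\<forall>s<r i. 0 \<le> \<theta> i \<pi> s) \<and> (\<Sum>s<r i. \<theta> i \<pi> s) = 1}"

definition joint :: "'v set \<Rightarrow> 'v rel \<Rightarrow> 'v params \<Rightarrow> ('v \<Rightarrow> nat) \<Rightarrow> real" where
  "joint U G \<theta> c = (\<Prod>i\<in>U. \<theta> i (restrict c (parents G i)) (c i))"

definition dag_equiv :: "'v set \<Rightarrow> ('v \<Rightarrow> nat) \<Rightarrow> 'v rel \<Rightarrow> 'v rel \<Rightarrow> bool" where
  "dag_equiv U r G G' \<longleftrightarrow>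
     (\<forall>\<theta>\<in>bn_params U r G. \<exists>\<theta>'\<in>bn_params U r G'.
        \<forall>c\<in>assignments r U. joint U G \<theta> c = joint U G' \<theta>' c) \<and>
     (\<forall>\<theta>'\<in>bn_params U r G'. \<exists>\<theta>\<in>bn_params U r G.
        \<forall>c\<in>assignments r U. joint U G \<theta> c = joint U G' \<theta>' c)"

text \<open>A list rather than a set of cases: the same case may occur several times.\<close>

definition database :: "'v set \<Rightarrow> ('v \<Rightarrow> nat) \<Rightarrow> ('v \<Rightarrow> nat) list \<Rightarrow> bool" where
  "database U r C \<longleftrightarrow> C \<noteq> [] \<and> set C \<subseteq> assignments r U"

definition likelihood :: "'v set \<Rightarrow> 'v rel \<Rightarrow> 'v params \<Rightarrow> ('v \<Rightarrow> nat) list \<Rightarrow> real" where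
  "likelihood U G \<theta> C = (\<Prod>l<length C. joint U G \<theta> (C ! l))"

text \<open>
  The maximum over all parameters; it is attained and positive, see
  \<open>ml_metric_attained\<close> and \<open>ml_metric_pos\<close> below.
\<close>

definition ml_metric ::
    "'v set \<Rightarrow> ('v \<Rightarrow> nat) \<Rightarrow> 'v rel \<Rightarrow> ('v \<Rightarrow> nat) list \<Rightarrow> real" where
  "ml_metric U r G C = (GREATEST L. \<exists>\<theta>\<in>bn_params U r G. L = likelihood U G \<theta> C)"

definition Dim :: "'v set \<Rightarrow> ('v \<Rightarrow> nat) \<Rightarrow> 'v rel \<Rightarrow> nat" where
  "Dim U r G = (\<Sum>i\<in>U. (r i - 1) * (\<Prod>j\<in>parents G i. r j))"

definition aic_metric ::
    "'v set \<Rightarrow> ('v \<Rightarrow> nat) \<Rightarrow> 'v rel \<Rightarrow> ('v \<Rightarrow> nat) list \<Rightarrow> real" where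
  "aic_metric U r G C = ln (ml_metric U r G C) - real (Dim U r G)"

definition score_equivalent ::
    "'v set \<Rightarrow> ('v \<Rightarrow> nat) \<Rightarrow> ('v rel \<Rightarrow> ('v \<Rightarrow> nat) list \<Rightarrow> real) \<Rightarrow> bool" where
  "score_equivalent U r M \<longleftrightarrow>
     (\<forall>G G' C. dag U G \<longrightarrow> dag U G' \<longrightarrow> database U r C \<longrightarrow>
        dag_equiv U r G G' \<longrightarrow> M G C = M G' C)"

lemma continuous_params_component:
  "continuous_on S (\<lambda>\<theta>::'v params. \<theta> i \<pi> s)"
proof -
  have 1: "continuous_on S (\<lambda>\<theta>::'v params. \<theta> i)"
    by (rule continuous_on_subset[OF continuous_on_product_coordinates]) simp
  have 2: "continuous_on UNIV (\<lambda>f::('v \<Rightarrow> nat) \<Rightarrow> nat \<Rightarrow> real. f \<pi>)"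
    by (intro continuous_on_product_coordinates)
  have 3: "continuous_on UNIV (\<lambda>f::nat \<Rightarrow> real. f s)"
    by (intro continuous_on_product_coordinates)
  show ?thesis
    using continuous_on_compose2[OF 3 continuous_on_compose2[OF 2 1]] by auto
qed

lemma restrict_parents:
  assumes "dag U G" "c \<in> assignments r U"
  shows "restrict c (parents G i) \<in> assignments r (parents G i)"
  using assms unfolding dag_def assignments_def parents_def by auto

lemma uniform_in_bn_params:
  assumes "\<forall>i\<in>U. 2 \<le> r i"
  shows "(\<lambda>i \<pi> s. 1 / real (r i)) \<in> bn_params U r G"
proof -
  have "\<forall>i\<in>U. r i \<noteq> 0" using assms by force
  then show ?thesis unfolding bn_params_def by auto
qed

lemma compact_PiE_UNIV:
  fixes S :: "'i \<Rightarrow> 'b::topological_space set"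
  assumes "\<And>i. compact (S i)"
  shows "compact (\<Pi>\<^sub>E i\<in>UNIV. S i)"
  using assms compactin_PiE[of "\<lambda>_. euclidean" UNIV S]
  by (simp add: euclidean_product_topology)

lemma likelihood_attains_max:
  assumes U: "finite U" and r: "\<forall>i\<in>U. 2 \<le> r i" and G: "dag U G" and C: "database U r C"
  shows "\<exists>\<theta>\<in>bn_params U r G. \<forall>\<theta>'\<in>bn_params U r G. likelihood U G \<theta>' C \<le> likelihood U G \<theta> C"
proof -
  define K :: "'a params set" where "K = (\<Pi>\<^sub>E i\<in>UNIV. \<Pi>\<^sub>E \<pi>\<in>UNIV. \<Pi>\<^sub>E s\<in>UNIV. {0..1})"
  define Q where "Q = K \<inter> bn_params U r G"
  have "compact K" unfolding K_def
    by (intro compact_PiE_UNIV) auto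
  moreover have "closed (bn_params U r G)"
  proof -
    have "bn_params U r G = (\<Inter>i\<in>U. \<Inter>\<pi>\<in>assignments r (parents G i).
        (\<Inter>s\<in>{..<r i}. {\<theta>. 0 \<le> \<theta> i \<pi> s}) \<inter> {\<theta>. (\<Sum>s<r i. \<theta> i \<pi> s) = 1})"
      unfolding bn_params_def by auto
    also have "closed \<dots>"
      by (intro closed_INT closed_Int ballI closed_Collect_le closed_Collect_eq
          continuous_on_const continuous_on_sum continuous_params_component)
    finally show ?thesis .
  qed
  ultimately have "compact Q" unfolding Q_def by (rule compact_Int_closed)
  have uni: "(\<lambda>i \<pi> s. 1 / real (r i)) \<in> bn_params U r G"
    by (rule uniform_in_bn_params[OF r])
  moreover have "(\<lambda>i \<pi> s. 1 / real (r i)) \<in> K"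
    unfolding K_def by (auto simp: divide_le_eq)
  ultimately have "Q \<noteq> {}" unfolding Q_def by blast
  have "continuous_on Q (\<lambda>\<theta>. likelihood U G \<theta> C)"
    unfolding likelihood_def joint_def
    by (intro continuous_on_prod continuous_params_component)
  from continuous_attains_sup[OF \<open>compact Q\<close> \<open>Q \<noteq> {}\<close> this]
  obtain \<theta> where \<theta>: "\<theta> \<in> Q" "\<forall>\<theta>'\<in>Q. likelihood U G \<theta>' C \<le> likelihood U G \<theta> C" by blast
  have "likelihood U G \<theta>' C \<le> likelihood U G \<theta> C" if t: "\<theta>' \<in> bn_params U r G" for \<theta>'
  proof -
    define \<eta> :: "'a params" where "\<eta> = (\<lambda>i \<pi> s. min 1 (max 0 (\<theta>' i \<pi> s)))"
    have eq: "\<eta> i \<pi> s = \<theta>' i \<pi> s"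
      if "i \<in> U" "\<pi> \<in> assignments r (parents G i)" "s < r i" for i \<pi> s
    proof -
      have nn: "\<forall>s<r i. 0 \<le> \<theta>' i \<pi> s" and s1: "(\<Sum>s<r i. \<theta>' i \<pi> s) = 1"
        using t that unfolding bn_params_def by auto
      have "\<theta>' i \<pi> s \<le> (\<Sum>s<r i. \<theta>' i \<pi> s)"
        by (rule member_le_sum) (use nn that in auto)
      then show ?thesis using nn s1 that unfolding \<eta>_def by auto
    qed
    have "\<eta> \<in> K" unfolding K_def \<eta>_def by auto
    moreover have "\<eta> \<in> bn_params U r G" using t eq unfolding bn_params_def by simp
    ultimately have "likelihood U G \<eta> C \<le> likelihood U G \<theta> C" using \<theta> unfolding Q_def by blast
    moreover have "likelihood U G \<eta> C = likelihood U G \<theta>' C"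
      unfolding likelihood_def joint_def
    proof (intro prod.cong refl)
      fix l i assume l: "l \<in> {..<length C}" and i: "i \<in> U"
      have c: "C ! l \<in> assignments r U" using C l unfolding database_def by auto
      then have "(C ! l) i < r i" using i unfolding assignments_def by auto
      then show "\<eta> i (restrict (C ! l) (parents G i)) ((C ! l) i) =
          \<theta>' i (restrict (C ! l) (parents G i)) ((C ! l) i)"
        using eq i restrict_parents[OF G c] by blast
    qed
    ultimately show ?thesis by simp
  qed
  then show ?thesis using \<theta>(1) unfolding Q_def by blast
qed

lemma ml_metric_attained:
  assumes "finite U" and "\<forall>i\<in>U. 2 \<le> r i" and "dag U G" and "database U r C"
  shows "\<exists>\<theta>\<in>bn_params U r G. ml_metric U r G C = likelihood U G \<theta> C \<and>
    (\<forall>\<theta>'\<in>bn_params U r G. likelihood U G \<theta>' C \<le> ml_metric U r G C)"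
proof -
  obtain \<theta> where \<theta>: "\<theta> \<in> bn_params U r G"
    "\<forall>\<theta>'\<in>bn_params U r G. likelihood U G \<theta>' C \<le> likelihood U G \<theta> C"
    using likelihood_attains_max[OF assms] by blast
  then have "ml_metric U r G C = likelihood U G \<theta> C"
    unfolding ml_metric_def by (intro Greatest_equality) auto
  then show ?thesis using \<theta> by auto
qed

lemma ml_metric_pos:
  assumes "finite U" and r: "\<forall>i\<in>U. 2 \<le> r i" and "dag U G" and "database U r C"
  shows "0 < ml_metric U r G C"
proof -
  have "0 < r i" if "i \<in> U" for i using r that by force
  then have "0 < likelihood U G (\<lambda>i \<pi> s. 1 / real (r i)) C"
    unfolding likelihood_def joint_def by (intro prod_pos) auto
  also have "\<dots> \<le> ml_metric U r G C"
    using ml_metric_attained[OF assms] uniform_in_bn_params[OF r] by blast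
  finally show ?thesis .
qed

end

theory Submission
  imports Defs
begin

text \<open>
  The maximum likelihood is a maximum over the distributions a dag can represent, so it only remains
  to see that equivalent dags have the same dimension. Expanding
  \<open>r j = (r j - 1) + 1\<close> shows that \<open>Dim U r G\<close> is the sum of \<open>\<Prod>j\<in>S. (r j - 1)\<close> over the sets
  \<open>S = {i} \<union> A\<close> with \<open>A\<close> a set of parents of \<open>i\<close>, and each such \<open>S\<close> arises from only one \<open>i\<close>.
  These sets can be read off from the representable distributions: \<open>S\<close> is of
  this form iff \<open>G\<close> represents the distribution proportional to \<open>1 + \<Prod>j\<in>S. \<chi> (x j)\<close>, where
  \<open>\<chi>\<close> has mean zero. Indeed, if \<open>i\<close> is a last element of \<open>S\<close> in \<open>G\<close>, the conditional
  probability of \<open>x i\<close> given its nondescendants is proportional to this function and thus depends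
  on all coordinates in \<open>S\<close>, while it may depend only on \<open>i\<close> and its parents.
\<close>

section \<open>Dimension as a sum over subsets of families\<close>

text \<open>On nonempty sets, the indicator function of this collection is the characteristic imset
  of \<open>G\<close>.\<close>

definition families :: "'v set \<Rightarrow> 'v rel \<Rightarrow> 'v set set" where
  "families U G = (\<Union>i\<in>U. insert i ` Pow (parents G i))"

lemma finite_parents:
  assumes "finite U" "dag U G"
  shows "finite (parents G i)"
  using assms by (auto simp: dag_def parents_def intro: finite_subset)

lemma parents_subset:
  assumes "dag U G"
  shows "parents G i \<subseteq> U"
  using assms by (auto simp: dag_def parents_def)

lemma parents_irrefl:
  assumes "dag U G"
  shows "i \<notin> parents G i"
  using assms by (auto simp: dag_def parents_def acyclic_def)

lemma parents_asym:
  assumes "dag U G" "j \<in> parents G i"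
  shows "i \<notin> parents G j"
  using assms by (auto simp: dag_def parents_def acyclic_def) (meson r_into_trancl trancl_trans)

lemma finite_assignments:
  assumes "finite A"
  shows "finite (assignments r A)"
  using assms unfolding assignments_def by (intro finite_PiE) auto

lemma prod_Suc_eq_sum_Pow:
  fixes f :: "'a \<Rightarrow> nat"
  assumes "finite A"
  shows "(\<Prod>j\<in>A. Suc (f j)) = (\<Sum>X\<in>Pow A. \<Prod>j\<in>X. f j)"
  using assms
proof (induction A rule: finite_induct)
  case (insert a A)
  have "(\<Sum>X\<in>Pow (insert a A). prod f X) =
      (\<Sum>X\<in>Pow A. prod f X) + (\<Sum>X\<in>insert a ` Pow A. prod f X)"
    unfolding Pow_insert using insert by (intro sum.union_disjoint) auto
  also have "(\<Sum>X\<in>insert a ` Pow A. prod f X) = (\<Sum>X\<in>Pow A. prod f (insert a X))"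
    using insert by (subst sum.reindex) (auto intro!: inj_onI)
  also have "\<dots> = (\<Sum>X\<in>Pow A. f a * prod f X)"
    using insert by (intro sum.cong refl prod.insert) (auto intro: finite_subset)
  finally show ?case using insert by (simp add: sum_distrib_left sum.distrib)
qed simp

lemma Dim_eq_sum_families:
  assumes U: "finite U" and r: "\<forall>i\<in>U. 2 \<le> r i" and G: "dag U G"
  shows "Dim U r G = (\<Sum>S\<in>families U G. \<Prod>j\<in>S. r j - 1)"
proof -
  have "(\<Sum>S\<in>families U G. \<Prod>j\<in>S. r j - 1) =
      (\<Sum>i\<in>U. \<Sum>S\<in>insert i ` Pow (parents G i). \<Prod>j\<in>S. r j - 1)"
    unfolding families_def
  proof (intro sum.UNION_disjoint U ballI impI)
    \<comment> \<open>A set arising from both \<open>i\<close> and \<open>k\<close> would contain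
      both nodes, making each a parent of the other.\<close>
    fix i k assume "i \<in> U" "k \<in> U" "i \<noteq> k"
    then show "insert i ` Pow (parents G i) \<inter> insert k ` Pow (parents G k) = {}"
      using parents_asym[OF G, of i k] by (auto simp: set_eq_iff) (metis subsetD)+
  qed (simp add: finite_parents[OF U G])
  also have "\<dots> = Dim U r G"
    unfolding Dim_def
  proof (intro sum.cong refl)
    fix i assume "i \<in> U"
    have fin: "finite (parents G i)" by (rule finite_parents[OF U G])
    have "inj_on (insert i) (Pow (parents G i))"
      using parents_irrefl[OF G, of i] by (auto intro!: inj_onI)
    then have "(\<Sum>S\<in>insert i ` Pow (parents G i). \<Prod>j\<in>S. r j - 1) =
        (\<Sum>A\<in>Pow (parents G i). \<Prod>j\<in>insert i A. r j - 1)"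
      by (simp add: sum.reindex)
    also have "\<dots> = (\<Sum>A\<in>Pow (parents G i). (r i - 1) * (\<Prod>j\<in>A. r j - 1))"
      using fin parents_irrefl[OF G, of i]
      by (intro sum.cong refl prod.insert) (auto intro: finite_subset)
    also have "\<dots> = (r i - 1) * (\<Prod>j\<in>parents G i. Suc (r j - 1))"
      by (simp only: prod_Suc_eq_sum_Pow[OF fin] sum_distrib_left)
    also have "(\<Prod>j\<in>parents G i. Suc (r j - 1)) = (\<Prod>j\<in>parents G i. r j)"
    proof (rule prod.cong[OF refl])
      fix j assume "j \<in> parents G i"
      then have "2 \<le> r j" using parents_subset[OF G] r by auto
      then show "Suc (r j - 1) = r j" by simp
    qed
    finally show "(\<Sum>S\<in>insert i ` Pow (parents G i). \<Prod>j\<in>S. r j - 1) =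
        (r i - 1) * (\<Prod>j\<in>parents G i. r j)" .
  qed
  finally show ?thesis by simp
qed

section \<open>Marginals on sets closed under parents\<close>

text \<open>The nodes outside \<open>A\<close> are summed out one at a time: enlarging
  \<open>A\<close> by a node \<open>m\<close> whose parents all lie in \<open>A\<close> adds one
  factor, and that factor sums to 1 over the states of \<open>m\<close>. The induction therefore
  runs from \<open>A = U\<close> downwards.\<close>

lemma marginal_joint:
  assumes U: "finite U" and G: "dag U G" and \<theta>: "\<theta> \<in> bn_params U r G"
    and "A \<subseteq> U" "\<And>k. k \<in> A \<Longrightarrow> parents G k \<subseteq> A" "c \<in> assignments r U"
  shows "(\<Sum>x | x \<in> assignments r U \<and> (\<forall>k\<in>A. x k = c k). joint U G \<theta> x) =
    (\<Prod>k\<in>A. \<theta> k (restrict c (parents G k)) (c k))"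
  using assms(4-6)
proof (induction "card (U - A)" arbitrary: A c rule: less_induct)
  case less
  show ?case
  proof (cases "A = U")
    case True
    have "{x. x \<in> assignments r U \<and> (\<forall>k\<in>U. x k = c k)} = {c}"
      using less.prems(3) unfolding assignments_def by (auto intro: PiE_ext)
    then show ?thesis using True by (simp add: joint_def)
  next
    case False
    have "finite G" using U G unfolding dag_def by (auto intro: finite_subset)
    then have "wf G" using G by (simp add: dag_def finite_acyclic_wf)
    moreover obtain m0 where "m0 \<in> U - A" using False less.prems(1) by blast
    \<comment> \<open>A source among the nodes outside \<open>A\<close>: its parents lie in
      \<open>A\<close>, so \<open>insert m A\<close> is again closed under parents.\<close>
    ultimately obtain m where m: "m \<in> U - A" "\<And>y. (y, m) \<in> G \<Longrightarrow> y \<notin> U - A"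
      by (metis wfE_min)
    have pm: "parents G m \<subseteq> A"
      using m(2) parents_subset[OF G, of m] by (auto simp: parents_def)
    have "(\<Sum>x | x \<in> assignments r U \<and> (\<forall>k\<in>A. x k = c k). joint U G \<theta> x) =
      (\<Sum>s<r m. \<Sum>x | x \<in> {x. x \<in> assignments r U \<and> (\<forall>k\<in>A. x k = c k)} \<and> x m = s.
         joint U G \<theta> x)"
      by (rule sum.group[symmetric])
        (use m finite_assignments[OF U] in \<open>auto simp: assignments_def\<close>)
    also have "\<dots> = (\<Sum>s<r m. \<theta> m (restrict c (parents G m)) s *
        (\<Prod>k\<in>A. \<theta> k (restrict c (parents G k)) (c k)))"
    proof (rule sum.cong[OF refl])
      fix s assume s: "s \<in> {..<r m}"
      \<comment> \<open>\<open>m\<close> is a parent neither of itself nor of any node in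
        \<open>A\<close>, so changing its state leaves all these parent configurations
        alone.\<close>
      have restr: "restrict (c(m := s)) (parents G k) = restrict c (parents G k)"
        if "k \<in> insert m A" for k
        using that pm less.prems(2)[of k] m(1) by (auto simp: restrict_def fun_eq_iff)
      have "{x. x \<in> {x. x \<in> assignments r U \<and> (\<forall>k\<in>A. x k = c k)} \<and> x m = s} =
          {x. x \<in> assignments r U \<and> (\<forall>k\<in>insert m A. x k = (c(m := s)) k)}"
        using m(1) by auto
      moreover have "(\<Sum>x | x \<in> assignments r U \<and> (\<forall>k\<in>insert m A. x k = (c(m := s)) k).
          joint U G \<theta> x) =
        (\<Prod>k\<in>insert m A. \<theta> k (restrict (c(m := s)) (parents G k)) ((c(m := s)) k))"
      proof (rule less.hyps)
        show "card (U - insert m A) < card (U - A)"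
          using U m(1) by (intro psubset_card_mono) auto
        show "c(m := s) \<in> assignments r U"
          using less.prems(3) m(1) s by (auto simp: assignments_def PiE_iff extensional_def)
      qed (use m(1) pm less.prems in auto)
      moreover have "(\<Prod>k\<in>insert m A. \<theta> k (restrict (c(m := s)) (parents G k)) ((c(m := s)) k)) =
          \<theta> m (restrict c (parents G m)) s * (\<Prod>k\<in>A. \<theta> k (restrict c (parents G k)) (c k))"
      proof -
        have "finite A" using less.prems(1) U by (rule finite_subset)
        then show ?thesis using m(1) restr
          by (subst prod.insert) (auto intro!: prod.cong)
      qed
      ultimately show "(\<Sum>x | x \<in> {x. x \<in> assignments r U \<and> (\<forall>k\<in>A. x k = c k)} \<and> x m = s.
          joint U G \<theta> x) =
        \<theta> m (restrict c (parents G m)) s * (\<Prod>k\<in>A. \<theta> k (restrict c (parents G k)) (c k))"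
        by simp
    qed
    also have "\<dots> = (\<Prod>k\<in>A. \<theta> k (restrict c (parents G k)) (c k))"
    proof -
      have "(\<Sum>s<r m. \<theta> m (restrict c (parents G m)) s) = 1"
        using \<theta> m(1) restrict_parents[OF G less.prems(3)] unfolding bn_params_def by blast
      then show ?thesis by (simp flip: sum_distrib_right)
    qed
    finally show ?thesis .
  qed
qed

section \<open>Test distributions detecting a set of nodes\<close>

text \<open>This is the \<chi> of the overview. States 0 and 1 exist for every variable, so they
  alone carry the contrast; all further states get the neutral value 0. Values within [-1, 1] keep 1
  plus a product of contrasts nonnegative.\<close>

definition contrast :: "nat \<Rightarrow> real" where
  "contrast s = (if s = 0 then 1 else if s = 1 then - 1 else 0)"

lemma sum_contrast:
  assumes "2 \<le> n"
  shows "(\<Sum>s<n. contrast s) = 0"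
proof -
  have "(\<Sum>s<n. contrast s) = (\<Sum>s\<in>{0, 1}. contrast s)"
    using assms by (intro sum.mono_neutral_right) (auto simp: contrast_def)
  then show ?thesis by (simp add: contrast_def)
qed

lemma abs_prod_contrast_le_1: "\<bar>\<Prod>j\<in>A. contrast (c j)\<bar> \<le> 1"
  unfolding abs_prod by (intro prod_le_1) (auto simp: contrast_def)

text \<open>Only the factor at \<open>i\<close> varies with \<open>s\<close>, and it has sum zero.
  Summing out one coordinate of \<open>S\<close> thus removes the interaction term.\<close>

lemma sum_prod_contrast_update:
  assumes "finite S" "i \<in> S" "2 \<le> n"
  shows "(\<Sum>s<n. \<Prod>j\<in>S. contrast ((c(i := s)) j)) = 0"
proof -
  have "(\<Prod>j\<in>S. contrast ((c(i := s)) j)) = contrast s * (\<Prod>j\<in>S - {i}. contrast (c j))" for s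
    using assms by (subst prod.remove[of S i]) auto
  then show ?thesis using sum_contrast[OF assms(3)] by (simp flip: sum_distrib_right)
qed

text \<open>Write \<open>S\<close> as \<open>insert i A\<close> with \<open>A\<close> among the
  parents of \<open>i\<close>. Every node other than \<open>i\<close> gets the uniform conditional
  law; that of \<open>i\<close> is the uniform law tilted by the interaction term, which is bounded
  by 1 and sums to zero over the states of \<open>i\<close>.\<close>

lemma joint_contrast:
  assumes U: "finite U" and r: "\<forall>i\<in>U. 2 \<le> r i" and G: "dag U G" and S: "S \<in> families U G"
  shows "\<exists>\<theta>\<in>bn_params U r G. \<forall>c\<in>assignments r U.
    joint U G \<theta> c = (1 + (\<Prod>j\<in>S. contrast (c j))) * (\<Prod>k\<in>U. 1 / real (r k))"
proof -
  obtain i A where i: "i \<in> U" and A: "A \<subseteq> parents G i" and SA: "S = insert i A"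
    using S unfolding families_def by blast
  have fA: "finite A" and iA: "i \<notin> A"
    using A finite_parents[OF U G] parents_irrefl[OF G] by (auto intro: finite_subset)
  define \<theta> :: "'a params" where "\<theta> = (\<lambda>k \<pi> s.
    (if k = i then 1 + contrast s * (\<Prod>j\<in>A. contrast (\<pi> j)) else 1) / real (r k))"
  have "0 \<le> \<theta> k \<pi> s" for k \<pi> s
  proof -
    have "\<bar>contrast s * (\<Prod>j\<in>A. contrast (\<pi> j))\<bar> \<le> 1"
      using abs_prod_contrast_le_1[of \<pi> A] by (auto simp: contrast_def)
    then have "0 \<le> 1 + contrast s * (\<Prod>j\<in>A. contrast (\<pi> j))" by linarith
    then show ?thesis by (simp add: \<theta>_def)
  qed
  moreover have "(\<Sum>s<r k. \<theta> k \<pi> s) = 1" if "k \<in> U" for k \<pi>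
  proof -
    have k: "2 \<le> r k" using r that by blast
    then have "(\<Sum>s<r k. contrast s * (\<Prod>j\<in>A. contrast (\<pi> j))) = 0"
      using sum_contrast[OF k] by (simp flip: sum_distrib_right)
    then show ?thesis using k
      by (cases "k = i") (simp_all add: \<theta>_def sum.distrib flip: sum_divide_distrib)
  qed
  ultimately have "\<theta> \<in> bn_params U r G" unfolding bn_params_def by blast
  moreover have "joint U G \<theta> c = (1 + (\<Prod>j\<in>S. contrast (c j))) * (\<Prod>k\<in>U. 1 / real (r k))" for c
  proof -
    have "(\<Prod>j\<in>A. contrast (restrict c (parents G i) j)) = (\<Prod>j\<in>A. contrast (c j))"
      using A by (intro prod.cong) auto
    then have "\<theta> i (restrict c (parents G i)) (c i) =
        (1 + (\<Prod>j\<in>S. contrast (c j))) * (1 / real (r i))"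
      using fA iA by (simp add: \<theta>_def SA)
    moreover have "(\<Prod>k\<in>U - {i}. \<theta> k (restrict c (parents G k)) (c k)) =
        (\<Prod>k\<in>U - {i}. 1 / real (r k))"
      by (intro prod.cong) (auto simp: \<theta>_def)
    ultimately show ?thesis
      unfolding joint_def using U i by (simp add: prod.remove[of U i])
  qed
  ultimately show ?thesis by blast
qed

text \<open>Converse of \<open>joint_contrast\<close>: the joint distribution determines the
  conditional law of a last node \<open>i\<close> of \<open>S\<close>, and that law reacts to each
  coordinate in \<open>S\<close>.\<close>

lemma joint_contrast_imp_families:
  assumes U: "finite U" and r: "\<forall>i\<in>U. 2 \<le> r i" and G: "dag U G"
    and S: "S \<subseteq> U" "S \<noteq> {}" and \<theta>: "\<theta> \<in> bn_params U r G"
    and joint: "\<And>c. c \<in> assignments r U \<Longrightarrow>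
      joint U G \<theta> c = (1 + (\<Prod>j\<in>S. contrast (c j))) * (\<Prod>k\<in>U. 1 / real (r k))"
  shows "S \<in> families U G"
proof -
  have fS: "finite S" using S U by (auto intro: finite_subset)
  have "finite G" using U G unfolding dag_def by (auto intro: finite_subset)
  then have "wf ((G\<inverse>)\<^sup>+)" using G by (simp add: dag_def finite_acyclic_wf_converse wf_trancl)
  \<comment> \<open>Minimality for the converse relation: no proper descendant of \<open>i\<close>
    lies in \<open>S\<close>.\<close>
  then obtain i where i: "i \<in> S" "\<And>y. (y, i) \<in> (G\<inverse>)\<^sup>+ \<Longrightarrow> y \<notin> S"
    using S(2) by (metis wfE_min ex_in_conv)
  have iU: "i \<in> U" using i S by blast
  have ri: "2 \<le> r i" using r iU by blast
  \<comment> \<open>The nondescendants of \<open>i\<close>, with \<open>i\<close> itself left out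
    because the closure is reflexive. Both \<open>B\<close> and \<open>insert i B\<close> are closed
    under parents, and the latter contains \<open>S\<close>.\<close>
  define B where "B = {k \<in> U. (i, k) \<notin> G\<^sup>*}"
  have iB: "i \<notin> B" by (simp add: B_def)
  have fB: "finite B" using U by (simp add: B_def)
  have SB: "S \<subseteq> insert i B"
    using i S(1) by (auto simp: B_def rtrancl_eq_or_trancl trancl_converse)
  have pB: "parents G k \<subseteq> B" if "k \<in> insert i B" for k
  proof
    fix j assume j: "j \<in> parents G k"
    have "(i, j) \<notin> G\<^sup>*"
    proof
      assume "(i, j) \<in> G\<^sup>*"
      then have *: "(i, k) \<in> G\<^sup>+" using j by (auto simp: parents_def intro: rtrancl_into_trancl1)
      then have "k \<noteq> i" using G by (auto simp: dag_def acyclic_def)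
      then show False using that * by (auto simp: B_def trancl_into_rtrancl)
    qed
    then show "j \<in> B" using j parents_subset[OF G, of k] by (auto simp: B_def)
  qed
  define u where "u = (\<Prod>k\<in>insert i B. 1 / real (r k))"
  have "\<forall>k\<in>insert i B. 0 < r k" using r iU by (force simp: B_def)
  then have u: "0 < u" unfolding u_def by (intro prod_pos) auto
  have marg: "(\<Prod>k\<in>insert i B. \<theta> k (restrict c (parents G k)) (c k)) =
      (1 + (\<Prod>j\<in>S. contrast (c j))) * u" if c: "c \<in> assignments r U" for c
  proof -
    let ?X = "{x. x \<in> assignments r U \<and> (\<forall>k\<in>insert i B. x k = c k)}"
    have anc: "insert i B \<subseteq> U" "\<And>k. k \<in> insert i B \<Longrightarrow> parents G k \<subseteq> insert i B"
      using iU pB by (auto simp: B_def)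
    have "(\<Prod>k\<in>insert i B. \<theta> k (restrict c (parents G k)) (c k)) = (\<Sum>x\<in>?X. joint U G \<theta> x)"
      by (rule marginal_joint[OF U G \<theta> anc c, symmetric])
    \<comment> \<open>The interaction term is constant on \<open>?X\<close>, since \<open>S\<close>
      lies in \<open>insert i B\<close>. What remains is the same marginal of the uniform
      distribution, namely \<open>u\<close>.\<close>
    also have "\<dots> = (\<Sum>x\<in>?X. (1 + (\<Prod>j\<in>S. contrast (c j))) *
        joint U G (\<lambda>i \<pi> s. 1 / real (r i)) x)"
    proof (rule sum.cong[OF refl])
      fix x assume x: "x \<in> ?X"
      then have "(\<Prod>j\<in>S. contrast (x j)) = (\<Prod>j\<in>S. contrast (c j))"
        using SB by (intro prod.cong) auto
      then show "joint U G \<theta> x = (1 + (\<Prod>j\<in>S. contrast (c j))) *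
          joint U G (\<lambda>i \<pi> s. 1 / real (r i)) x"
        using x joint[of x] by (simp add: joint_def)
    qed
    also have "\<dots> = (1 + (\<Prod>j\<in>S. contrast (c j))) * u"
      using marginal_joint[OF U G uniform_in_bn_params[OF r] anc c]
      by (simp only: u_def flip: sum_distrib_left)
    finally show ?thesis .
  qed
  have cond: "\<theta> i (restrict c (parents G i)) (c i) = (1 + (\<Prod>j\<in>S. contrast (c j))) / real (r i)"
    if c: "c \<in> assignments r U" for c
  proof -
    \<comment> \<open>The marginal probability of \<open>c\<close> on \<open>B\<close>. Summing
      \<open>upd\<close> over all states of \<open>i\<close> evaluates it: \<theta> sums to 1 on the
      left, the contrasts cancel on the right.\<close>
    define b where "b = (\<Prod>k\<in>B. \<theta> k (restrict c (parents G k)) (c k))"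
    have upd: "\<theta> i (restrict c (parents G i)) s * b = (1 + (\<Prod>j\<in>S. contrast ((c(i := s)) j))) * u"
      if s: "s < r i" for s
    proof -
      have c': "c(i := s) \<in> assignments r U"
        using c iU s by (auto simp: assignments_def PiE_iff extensional_def)
      have restr: "restrict (c(i := s)) (parents G k) = restrict c (parents G k)"
        if "k \<in> insert i B" for k
        using pB[OF that] iB by (auto simp: restrict_def fun_eq_iff)
      have "(\<Prod>k\<in>insert i B. \<theta> k (restrict (c(i := s)) (parents G k)) ((c(i := s)) k)) =
          \<theta> i (restrict c (parents G i)) s * b"
        unfolding b_def using fB iB restr by (subst prod.insert) (auto intro!: prod.cong)
      then show ?thesis using marg[OF c'] by simp
    qed
    have "(\<Sum>s<r i. \<theta> i (restrict c (parents G i)) s) = 1"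
      using \<theta> iU restrict_parents[OF G c] unfolding bn_params_def by blast
    then have "b = (\<Sum>s<r i. \<theta> i (restrict c (parents G i)) s * b)"
      by (simp flip: sum_distrib_right)
    also have "\<dots> = (\<Sum>s<r i. (1 + (\<Prod>j\<in>S. contrast ((c(i := s)) j))) * u)"
      by (intro sum.cong refl upd) simp
    also have "\<dots> = (real (r i) + (\<Sum>s<r i. \<Prod>j\<in>S. contrast ((c(i := s)) j))) * u"
      by (simp only: sum_distrib_right[symmetric] sum.distrib) simp
    also have "\<dots> = real (r i) * u" using sum_prod_contrast_update[OF fS i(1) ri] by simp
    finally have "b = real (r i) * u" .
    moreover have "c i < r i" using c iU by (auto simp: assignments_def)
    ultimately have "\<theta> i (restrict c (parents G i)) (c i) * real (r i) * u =
        (1 + (\<Prod>j\<in>S. contrast (c j))) * u"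
      using upd[of "c i"] by (simp add: mult.assoc)
    then have "\<theta> i (restrict c (parents G i)) (c i) * real (r i) = 1 + (\<Prod>j\<in>S. contrast (c j))"
      using u by simp
    then show ?thesis using ri by (simp add: eq_divide_eq)
  qed
  have "S - {i} \<subseteq> parents G i"
  proof (rule ccontr)
    assume "\<not> S - {i} \<subseteq> parents G i"
    then obtain j where j: "j \<in> S" "j \<noteq> i" "j \<notin> parents G i" by blast
    \<comment> \<open>Moving a non-parent \<open>j\<close> from state 0 to state 1 preserves the
      parent configuration and the state of \<open>i\<close>, but flips the product of contrasts
      from 1 to -1.\<close>
    define c :: "'a \<Rightarrow> nat" where "c = restrict (\<lambda>_. 0) U"
    have r0: "0 < r k" "1 < r k" if "k \<in> U" for k using r that by force+
    have c: "c \<in> assignments r U" "c(j := 1) \<in> assignments r U"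
      using r0 j S(1) by (auto simp: c_def assignments_def PiE_iff extensional_def)
    have c0: "c k = 0" if "k \<in> S" for k using that S(1) by (auto simp: c_def)
    have "restrict (c(j := 1)) (parents G i) = restrict c (parents G i)"
      using j by (auto simp: restrict_def fun_eq_iff)
    then have "(1 + (\<Prod>k\<in>S. contrast ((c(j := 1)) k))) / real (r i) =
        (1 + (\<Prod>k\<in>S. contrast (c k))) / real (r i)"
      using cond[OF c(1)] cond[OF c(2)] j(2) by (metis fun_upd_other)
    moreover have "(\<Prod>k\<in>S. contrast (c k)) = 1"
      using c0 by (intro prod.neutral) (auto simp: contrast_def)
    moreover have "(\<Prod>k\<in>S. contrast ((c(j := 1)) k)) = - 1"
    proof -
      have "(\<Prod>k\<in>S - {j}. contrast ((c(j := 1)) k)) = 1"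
        using c0 by (intro prod.neutral) (auto simp: contrast_def)
      then show ?thesis
        unfolding prod.remove[OF fS j(1)] by (simp add: contrast_def)
    qed
    ultimately show False using ri by simp
  qed
  moreover have "S = insert i (S - {i})" using i(1) by blast
  ultimately show ?thesis using iU unfolding families_def by blast
qed

section \<open>Invariance under equivalence\<close>

text \<open>The test distribution of \<open>S\<close> is represented by \<open>G\<close>, hence by
  \<open>G'\<close>, where it forces \<open>S\<close> to come from a node and some of its
  parents.\<close>

lemma families_mono:
  assumes U: "finite U" and r: "\<forall>i\<in>U. 2 \<le> r i" and G: "dag U G" and G': "dag U G'"
    and sub: "\<And>\<theta>. \<theta> \<in> bn_params U r G \<Longrightarrow> \<exists>\<theta>'\<in>bn_params U r G'.
      \<forall>c\<in>assignments r U. joint U G \<theta> c = joint U G' \<theta>' c"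
  shows "families U G \<subseteq> families U G'"
proof
  fix S assume S: "S \<in> families U G"
  have "S \<subseteq> U" "S \<noteq> {}"
    using S parents_subset[OF G] unfolding families_def by blast+
  obtain \<theta> where "\<theta> \<in> bn_params U r G" and \<theta>: "\<forall>c\<in>assignments r U.
      joint U G \<theta> c = (1 + (\<Prod>j\<in>S. contrast (c j))) * (\<Prod>k\<in>U. 1 / real (r k))"
    using joint_contrast[OF U r G S] by blast
  then obtain \<theta>' where \<theta>': "\<theta>' \<in> bn_params U r G'"
      "\<forall>c\<in>assignments r U. joint U G \<theta> c = joint U G' \<theta>' c"
    using sub by blast
  show "S \<in> families U G'"
    by (rule joint_contrast_imp_families[OF U r G' \<open>S \<subseteq> U\<close> \<open>S \<noteq> {}\<close> \<theta>'(1)])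
      (use \<theta> \<theta>'(2) in simp)
qed

lemma Dim_cong:
  assumes U: "finite U" and r: "\<forall>i\<in>U. 2 \<le> r i" and G: "dag U G" and G': "dag U G'"
    and equiv: "dag_equiv U r G G'"
  shows "Dim U r G = Dim U r G'"
proof -
  have "families U G \<subseteq> families U G'"
    using equiv by (intro families_mono[OF U r G G']) (auto simp: dag_equiv_def)
  moreover have "families U G' \<subseteq> families U G"
  proof (rule families_mono[OF U r G' G])
    fix \<theta>' assume "\<theta>' \<in> bn_params U r G'"
    then obtain \<theta> where "\<theta> \<in> bn_params U r G"
        "\<forall>c\<in>assignments r U. joint U G \<theta> c = joint U G' \<theta>' c"
      using equiv unfolding dag_equiv_def by blast
    then show "\<exists>\<theta>\<in>bn_params U r G. \<forall>c\<in>assignments r U. joint U G' \<theta>' c = joint U G \<theta> c"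
      by (intro bexI[of _ \<theta>]) simp_all
  qed
  ultimately show ?thesis
    by (simp add: Dim_eq_sum_families[OF U r G] Dim_eq_sum_families[OF U r G'])
qed

lemma likelihood_cong:
  assumes "database U r C" "\<forall>c\<in>assignments r U. joint U G \<theta> c = joint U G' \<theta>' c"
  shows "likelihood U G \<theta> C = likelihood U G' \<theta>' C"
  unfolding likelihood_def
  using assms by (intro prod.cong refl) (auto simp: database_def subset_iff)

text \<open>Equivalent dags attain exactly the same likelihood values, so both
  \<open>GREATEST\<close> expressions select from the same set.\<close>

lemma ml_metric_cong:
  assumes "database U r C" "dag_equiv U r G G'"
  shows "ml_metric U r G C = ml_metric U r G' C"
proof -
  have "(\<exists>\<theta>\<in>bn_params U r G. L = likelihood U G \<theta> C) \<longleftrightarrow>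
      (\<exists>\<theta>\<in>bn_params U r G'. L = likelihood U G' \<theta> C)" for L
    using assms(2) likelihood_cong[OF assms(1)] unfolding dag_equiv_def by metis
  then show ?thesis by (simp add: ml_metric_def)
qed

theorem theorem4:
  fixes U :: "'v set" and r :: "'v \<Rightarrow> nat"
  assumes "finite U"
    and "\<forall>i\<in>U. 2 \<le> r i"
  shows "score_equivalent U r (aic_metric U r)"
  unfolding score_equivalent_def aic_metric_def
  using ml_metric_cong Dim_cong[OF assms] by metis

end
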